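(* Let $n, m$ be integers with $0 \le m \le n$, let $D$ be a digraph with vertex set $[n]$, and let $s=(s_1,\dots,s_m) \in [n]^m$. Then $s$ is a parking function on $D$ if and only if for all $B \subseteq [n]$ we have \[ |\{i \in [m] : s_i \in R_D(B)\}| \le |R_D(B)|. \]
   Context: $[n]=\{1,\dots,n\}$. Parking process: given $0\le m\le n$, a sequence $s\in[n]^m$ and a digraph $D$ with vertex set $[n]$ (loops allowed), drivers $1,\dots,m$ attempt to park one by one, in this order. Driver $i$ begins at vertex $s_i$. If the current vertex is unoccupied, the driver parks there; if it is occupied, the driver chooses an out-neighbor of the current vertex and drives there, and repeats this until she parks (and then the next driver enters) or is unable to find an available spot (and then the process terminates). Thus each driver follows a directed walk of her choice starting at $s_i$ and parks at the first unoccupied vertex on it. The sequence $s$ is a parking function on $D$ if it is possible (for some choices of the drivers) for all $m$ drivers to park. For $i,j\in[n]$ write $i \preceq_D j$ if there is a directed path from $i$ to $j$ in $D$, with the convention $i\preceq_D i$. Put $R_D(i)=\{j\in[n] : i\preceq_D j\}$ and, for $B\subseteq[n]$, $R_D(B)=\bigcup_{i\in B}R_D(i)$. *)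

theory Defs
  imports Main
begin

text \<open>A digraph (loops allowed) with vertex set \<open>{1..n}\<close> is given by its set of edges
  \<open>D \<subseteq> {1..n} \<times> {1..n}\<close>; the edge \<open>(u, v)\<close> is directed from \<open>u\<close> to \<open>v\<close>.\<close>

text \<open>\<open>drives D S v w\<close>: when exactly the vertices in \<open>S\<close> are occupied, a driver currently at \<open>v\<close>
  can choose her moves so that she parks at \<open>w\<close>.  Being inductive, it only admits drives that end
  after finitely many moves.\<close>

inductive drives :: "(nat \<times> nat) set \<Rightarrow> nat set \<Rightarrow> nat \<Rightarrow> nat \<Rightarrow> bool"
  for D :: "(nat \<times> nat) set" and S :: "nat set"
where
  park: "v \<notin> S \<Longrightarrow> drives D S v v"
| move: "v \<in> S \<Longrightarrow> (v, u) \<in> D \<Longrightarrow> drives D S u w \<Longrightarrow> drives D S v w"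

text \<open>The witness \<open>p i\<close> is the vertex where driver \<open>i\<close> parks, so that \<open>p ` {1..<i}\<close> is the set of
  vertices occupied when driver \<open>i\<close> enters.  Only the values of \<open>s\<close> on \<open>{1..m}\<close> matter.\<close>

definition parking_function :: "(nat \<times> nat) set \<Rightarrow> nat \<Rightarrow> (nat \<Rightarrow> nat) \<Rightarrow> bool" where
  "parking_function D m s \<longleftrightarrow>
     (\<exists>p. \<forall>i\<in>{1..m}. drives D (p ` {1..<i}) (s i) (p i))"

definition reaches :: "(nat \<times> nat) set \<Rightarrow> nat \<Rightarrow> nat \<Rightarrow> bool" where
  "reaches D i j \<longleftrightarrow> (i, j) \<in> D\<^sup>*"

definition reach :: "nat \<Rightarrow> (nat \<times> nat) set \<Rightarrow> nat \<Rightarrow> nat set" where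
  "reach n D i = {j \<in> {1..n}. reaches D i j}"

definition reach_set :: "nat \<Rightarrow> (nat \<times> nat) set \<Rightarrow> nat set \<Rightarrow> nat set" where
  "reach_set n D B = (\<Union>i\<in>B. reach n D i)"

end

theory Submission imports Defs begin

text \<open>
  Necessity holds because the drivers who start in a set \<open>R\<close> that no edge leaves also park in
  \<open>R\<close>, at distinct vertices; the sets \<open>reach_set n D B\<close> are exactly such closed sets
  (\<open>reach_set_closed\<close> and \<open>reach_set_of_closed\<close>).

  For sufficiency the drivers must choose well: a driver may take a spot on which a later driver
  depends.  The drivers maintain the invariant \<open>has_room\<close>: in every closed set there are at least
  as many free vertices as waiting drivers who start in it.  The theorem's inequalities are this
  invariant for the empty parking lot, and \<open>has_room_park\<close> shows that the next driver, starting at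
  \<open>v\<close>, can always preserve it.  The invariant can only be destroyed by parking in a closed set that
  is tight (free vertices and waiting drivers are equally many) and does not contain \<open>v\<close>, since the
  driver then uses up a spot there without having been counted.  The union of two tight sets is
  tight, so there is a largest tight set \<open>T\<close> avoiding \<open>v\<close>.  The inequality for the union of \<open>T\<close> and
  the set of vertices reachable from \<open>v\<close> yields a free vertex reachable from \<open>v\<close> outside \<open>T\<close>.
  Driving towards it, the driver may have to stop earlier, but never inside \<open>T\<close>, because \<open>T\<close>
  cannot be left.  Choosing a whole matching of drivers to spots in advance is thus avoided.
\<close>

section \<open>Drives and closed sets\<close>

lemma drives_free: "drives D S v w \<Longrightarrow> w \<notin> S"
  by (induction rule: drives.induct)

lemma drives_reachable: "drives D S v w \<Longrightarrow> (v, w) \<in> D\<^sup>*"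
  by (induction rule: drives.induct) (auto intro: converse_rtrancl_into_rtrancl)

lemma closed_rtrancl: "(v, w) \<in> D\<^sup>* \<Longrightarrow> D `` C \<subseteq> C \<Longrightarrow> v \<in> C \<Longrightarrow> w \<in> C"
  by (induction rule: rtrancl_induct) auto

text \<open>A driver who heads for a free vertex \<open>x\<close> parks somewhere on the way, and her spot still
  reaches \<open>x\<close>.  This is what keeps her out of closed sets that do not contain \<open>x\<close>.\<close>

lemma drive_towards:
  assumes "(v, x) \<in> D\<^sup>*" "x \<notin> S"
  shows "\<exists>w. drives D S v w \<and> (w, x) \<in> D\<^sup>*"
  using assms(1)
proof (induction rule: converse_rtrancl_induct)
  case base
  show ?case using assms(2) drives.park by blast
next
  case (step v u)
  show ?case
  proof (cases "v \<in> S")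
    case True
    then show ?thesis using step drives.move by blast
  next
    case False
    then show ?thesis
      using step drives.park converse_rtrancl_into_rtrancl by metis
  qed
qed

lemma reach_set_closed:
  assumes "D \<subseteq> {1..n} \<times> {1..n}"
  shows "D `` reach_set n D B \<subseteq> reach_set n D B"
  using assms rtrancl_into_rtrancl[of _ _ D]
  unfolding reach_set_def reach_def reaches_def by blast

lemma reach_set_of_closed:
  assumes "D `` C \<subseteq> C" "C \<subseteq> {1..n}"
  shows "reach_set n D C = C"
  using assms closed_rtrancl[of _ _ D C]
  unfolding reach_set_def reach_def reaches_def by blast

section \<open>The invariant on free spots\<close>

definition has_room ::
  "(nat \<times> nat) set \<Rightarrow> nat set \<Rightarrow> nat set \<Rightarrow> 'i set \<Rightarrow> ('i \<Rightarrow> nat) \<Rightarrow> bool" where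
  "has_room D V S J s \<longleftrightarrow>
     (\<forall>C\<subseteq>V. D `` C \<subseteq> C \<longrightarrow> card {i \<in> J. s i \<in> C} \<le> card (C - S))"

lemma has_roomD:
  "has_room D V S J s \<Longrightarrow> C \<subseteq> V \<Longrightarrow> D `` C \<subseteq> C \<Longrightarrow> card {i \<in> J. s i \<in> C} \<le> card (C - S)"
  by (simp add: has_room_def)

text \<open>Both sides of the inequality in the invariant are modular in the closed set, and the
  inequality also holds for the intersection.  Equality for two sets therefore forces equality for
  their union.\<close>

lemma tight_Un:
  assumes "finite V" "finite J" and room: "has_room D V S J s"
    and A: "A \<subseteq> V" "D `` A \<subseteq> A" "card {i \<in> J. s i \<in> A} = card (A - S)"
    and B: "B \<subseteq> V" "D `` B \<subseteq> B" "card {i \<in> J. s i \<in> B} = card (B - S)"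
  shows "card {i \<in> J. s i \<in> A \<union> B} = card (A \<union> B - S)"
proof -
  let ?d = "\<lambda>C. {i \<in> J. s i \<in> C}"
  have "finite A" "finite B"
    using finite_subset[OF A(1) assms(1)] finite_subset[OF B(1) assms(1)] .
  moreover have "(A - S) \<union> (B - S) = A \<union> B - S" "(A - S) \<inter> (B - S) = A \<inter> B - S" by auto
  ultimately have "card (A - S) + card (B - S) = card (A \<union> B - S) + card (A \<inter> B - S)"
    using card_Un_Int[of "A - S" "B - S"] by (metis finite_Diff)
  moreover have "card (?d A) + card (?d B) = card (?d (A \<union> B)) + card (?d (A \<inter> B))"
  proof -
    have "?d (A \<union> B) = ?d A \<union> ?d B" "?d (A \<inter> B) = ?d A \<inter> ?d B" by auto
    then show ?thesis using card_Un_Int[of "?d A" "?d B"] assms(2) by simp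
  qed
  moreover have "card (?d (A \<union> B)) \<le> card (A \<union> B - S)"
    using A B by (intro has_roomD[OF room]) auto
  moreover have "card (?d (A \<inter> B)) \<le> card (A \<inter> B - S)"
    using A B by (intro has_roomD[OF room]) auto
  ultimately show ?thesis using A(3) B(3) by linarith
qed

text \<open>Tight sets that avoid \<open>v\<close> form a finite nonempty family (the empty set is tight), so a tight
  set of maximal size exists; by \<open>tight_Un\<close> it contains all others.\<close>

lemma obtain_largest_tight:
  assumes "finite V" "finite J" and room: "has_room D V S J s"
  obtains T where "T \<subseteq> V" "D `` T \<subseteq> T" "card {i \<in> J. s i \<in> T} = card (T - S)" "v \<notin> T"
    and "\<forall>C\<subseteq>V. D `` C \<subseteq> C \<longrightarrow> card {i \<in> J. s i \<in> C} = card (C - S) \<longrightarrow> v \<notin> C \<longrightarrow> C \<subseteq> T"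
proof -
  define tight where "tight = (\<lambda>C. C \<subseteq> V \<and> D `` C \<subseteq> C \<and>
    card {i \<in> J. s i \<in> C} = card (C - S) \<and> v \<notin> C)"
  have "finite {C. tight C}"
    by (rule finite_subset[of _ "Pow V"]) (auto simp: tight_def assms(1))
  moreover have "tight {}" by (simp add: tight_def)
  ultimately obtain T where T: "tight T" and max: "\<And>C. tight C \<Longrightarrow> T \<subseteq> C \<Longrightarrow> C = T"
    using finite_has_maximal[of "{C. tight C}"] by blast
  have "C \<subseteq> T" if "tight C" for C
  proof -
    have "tight (T \<union> C)"
      using T that tight_Un[OF assms, of T C] unfolding tight_def by blast
    then show ?thesis using max[of "T \<union> C"] by blast
  qed
  then show ?thesis using that[of T] T unfolding tight_def by blast
qed

text \<open>Parking at \<open>w\<close> uses up one free spot in every closed set around \<open>w\<close>.  If \<open>s i\<close> lies in that set,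
  one waiting driver disappears from it as well; otherwise the set has a spot to spare, because it
  is not contained in the largest tight set avoiding \<open>s i\<close> and so is not tight.\<close>

lemma has_room_park:
  assumes "finite V" "finite J" "D `` V \<subseteq> V" and room: "has_room D V S J s"
    and "i \<in> J" "s i \<in> V"
  shows "\<exists>w. drives D S (s i) w \<and> has_room D V (insert w S) (J - {i}) s"
proof -
  obtain T where T: "T \<subseteq> V" "D `` T \<subseteq> T" "card {j \<in> J. s j \<in> T} = card (T - S)" "s i \<notin> T"
    and largest: "\<forall>C\<subseteq>V. D `` C \<subseteq> C \<longrightarrow> card {j \<in> J. s j \<in> C} = card (C - S) \<longrightarrow>
      s i \<notin> C \<longrightarrow> C \<subseteq> T"
    by (rule obtain_largest_tight[OF assms(1,2) room, where v = "s i"])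
  define R where "R = D\<^sup>* `` {s i}"
  have R: "R \<subseteq> V" "D `` R \<subseteq> R" "s i \<in> R"
    using closed_rtrancl[OF _ assms(3)] assms(6) by (auto simp: R_def)
  \<comment> \<open>Beyond the drivers starting in \<open>T\<close>, the driver \<open>i\<close> herself starts in the union with \<open>R\<close>.\<close>
  have "card (T - S) < card {j \<in> J. s j \<in> R \<union> T}"
    unfolding T(3)[symmetric] using assms(2,5) R(3) T(4)
    by (intro psubset_card_mono) auto
  also have "\<dots> \<le> card (R \<union> T - S)"
    using R T by (intro has_roomD[OF room]) auto
  finally have less: "card (T - S) < card (R \<union> T - S)" .
  have "\<not> R \<union> T - S \<subseteq> T - S"
    using less card_mono[of "T - S" "R \<union> T - S"] finite_subset[OF T(1) assms(1)] by auto
  then obtain x where x: "x \<in> R" "x \<notin> T" "x \<notin> S" by blast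
  then obtain w where w: "drives D S (s i) w" "(w, x) \<in> D\<^sup>*"
    using drive_towards[of "s i" x D S] by (auto simp: R_def)
  have "w \<notin> T" using closed_rtrancl[OF w(2) T(2)] x(2) by blast
  have "w \<notin> S" using drives_free w(1) .
  have "card {j \<in> J - {i}. s j \<in> C} \<le> card (C - insert w S)"
    if C: "C \<subseteq> V" "D `` C \<subseteq> C" for C
  proof (cases "w \<in> C")
    case False
    then have "C - insert w S = C - S" by auto
    moreover have "card {j \<in> J - {i}. s j \<in> C} \<le> card {j \<in> J. s j \<in> C}"
      using assms(2) by (intro card_mono) auto
    ultimately show ?thesis using has_roomD[OF room C] by simp
  next
    case True
    have "C - insert w S = (C - S) - {w}" by auto
    then have spots: "card (C - insert w S) = card (C - S) - 1"
      using True \<open>w \<notin> S\<close> by simp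
    show ?thesis
    proof (cases "s i \<in> C")
      case True
      have "{j \<in> J - {i}. s j \<in> C} = {j \<in> J. s j \<in> C} - {i}" by auto
      then have "card {j \<in> J - {i}. s j \<in> C} = card {j \<in> J. s j \<in> C} - 1"
        using True assms(5) by simp
      then show ?thesis using has_roomD[OF room C] spots by simp
    next
      case False
      have "card {j \<in> J. s j \<in> C} \<noteq> card (C - S)"
        using largest[rule_format, OF C _ False] True \<open>w \<notin> T\<close> by blast
      then have "card {j \<in> J. s j \<in> C} < card (C - S)"
        using has_roomD[OF room C] by linarith
      moreover have "{j \<in> J - {i}. s j \<in> C} = {j \<in> J. s j \<in> C}" using False by auto
      ultimately show ?thesis using spots by simp
    qed
  qed
  then have "has_room D V (insert w S) (J - {i}) s" by (simp add: has_room_def)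
  then show ?thesis using w(1) by blast
qed

section \<open>Characterization of parking functions\<close>

lemma parking_function_if_has_room:
  assumes "finite V" "D `` V \<subseteq> V" "\<forall>i\<in>{1..m}. s i \<in> V"
    and room: "has_room D V {} {1..m} s"
  shows "parking_function D m s"
proof -
  have "\<exists>p. (\<forall>i\<in>{1..k}. drives D (p ` {1..<i}) (s i) (p i)) \<and>
      has_room D V (p ` {1..k}) {k<..m} s" if "k \<le> m" for k
    using that
  proof (induction k)
    case 0
    have "{0<..m} = {1..m}" by auto
    then show ?case using room by simp
  next
    case (Suc k)
    then obtain p where p: "\<forall>i\<in>{1..k}. drives D (p ` {1..<i}) (s i) (p i)"
      and inv: "has_room D V (p ` {1..k}) {k<..m} s" by auto
    obtain w where w: "drives D (p ` {1..k}) (s (Suc k)) w"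
      and inv': "has_room D V (insert w (p ` {1..k})) ({k<..m} - {Suc k}) s"
      using has_room_park[OF assms(1) _ assms(2) inv, of "Suc k"] assms(3) Suc.prems by auto
    let ?p = "p(Suc k := w)"
    have old: "?p ` A = p ` A" if "A \<subseteq> {..k}" for A
      using that by (intro image_cong) auto
    have "drives D (?p ` {1..<i}) (s i) (?p i)" if "i \<in> {1..Suc k}" for i
    proof (cases "i = Suc k")
      case True
      then show ?thesis using w old[of "{1..k}"] by (simp add: atLeastLessThanSuc_atLeastAtMost)
    next
      case False
      then show ?thesis using p that old[of "{1..<i}"] by auto
    qed
    moreover have "?p ` {1..Suc k} = insert w (p ` {1..k})"
    proof -
      have "{1..Suc k} = insert (Suc k) {1..k}" by auto
      then have "?p ` {1..Suc k} = insert w (?p ` {1..k})" by (metis fun_upd_same image_insert)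
      then show ?thesis using old[of "{1..k}"] by auto
    qed
    moreover have "{Suc k<..m} = {k<..m} - {Suc k}" by auto
    ultimately show ?case using inv' by (intro exI[of _ ?p]) auto
  qed
  then show ?thesis unfolding parking_function_def by blast
qed

lemma parking_function_card_le:
  assumes "parking_function D m s" "finite C" "D `` C \<subseteq> C"
  shows "card {i \<in> {1..m}. s i \<in> C} \<le> card C"
proof -
  obtain p where p: "\<And>i. i \<in> {1..m} \<Longrightarrow> drives D (p ` {1..<i}) (s i) (p i)"
    using assms(1) unfolding parking_function_def by blast
  have "p j \<noteq> p i" if "j \<in> {1..m}" "i \<in> {1..m}" "j < i" for i j
    using drives_free[OF p[OF that(2)]] that by (metis atLeastAtMost_iff atLeastLessThan_iff imageI)
  then have "inj_on p {1..m}"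
    by (intro linorder_inj_onI) auto
  then have "inj_on p {i \<in> {1..m}. s i \<in> C}"
    by (rule inj_on_subset) auto
  moreover have "p ` {i \<in> {1..m}. s i \<in> C} \<subseteq> C"
    using closed_rtrancl[OF drives_reachable[OF p] assms(3)] by auto
  ultimately show ?thesis using assms(2) by (rule card_inj_on_le)
qed

theorem corollary1:
  fixes n m :: nat and D :: "(nat \<times> nat) set" and s :: "nat \<Rightarrow> nat"
  assumes "m \<le> n"
    and "D \<subseteq> {1..n} \<times> {1..n}"
    and "\<forall>i\<in>{1..m}. s i \<in> {1..n}"
  shows "parking_function D m s \<longleftrightarrow>
    (\<forall>B\<subseteq>{1..n}. card {i \<in> {1..m}. s i \<in> reach_set n D B} \<le> card (reach_set n D B))"
proof
  assume park: "parking_function D m s"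
  have "finite (reach_set n D B)" for B
    by (rule finite_subset[of _ "{1..n}"]) (auto simp: reach_set_def reach_def)
  then show "\<forall>B\<subseteq>{1..n}. card {i \<in> {1..m}. s i \<in> reach_set n D B} \<le> card (reach_set n D B)"
    using parking_function_card_le[OF park] reach_set_closed[OF assms(2)] by blast
next
  assume le: "\<forall>B\<subseteq>{1..n}. card {i \<in> {1..m}. s i \<in> reach_set n D B} \<le> card (reach_set n D B)"
  have "has_room D {1..n} {} {1..m} s"
    unfolding has_room_def
  proof (intro allI impI)
    fix C assume C: "C \<subseteq> {1..n}" "D `` C \<subseteq> C"
    then show "card {i \<in> {1..m}. s i \<in> C} \<le> card (C - {})"
      using le[rule_format, OF C(1)] reach_set_of_closed[OF C(2,1)] by simp
  qed
  moreover have "D `` {1..n} \<subseteq> {1..n}" using assms(2) by auto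
  ultimately show "parking_function D m s"
    using assms(3) by (intro parking_function_if_has_room[where V = "{1..n}"]) auto
qed

end
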